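(* Let $n\ge2$, $r>0$, $\zeta=2\pi/n$, $\omega=(n-1)\frac{1-r^4}{8r^2}$, and $k\in\{1,\dots,n\}$. Let $q_j(t)=e^{i\omega t}x_j(\nu t)$, $j=1,\dots,n$, be a relative periodic solution of the $n$-vortex problem on the sphere (in stereographic coordinates), with $x_j$ $2\pi$-periodic, with symmetry group $\tilde{\mathbb{Z}}_n(k)$ and frequency $\nu=\omega\,(m/\ell)>0$, where $\ell$ and $m$ are nonzero relatively prime integers such that $k\ell-m\in n\mathbb{Z}$. Let $$Q_j(t)=q_j(t/\nu)=e^{it\omega/\nu}x_j(t).$$ Then $$Q_j(t)=Q_n(t+j\tilde k\zeta),\qquad j=1,\dots,n,$$ where $\tilde k=k-(k\ell-m)\ell^{*}$ and $\ell^{*}$ is the $m$-modular inverse of $\ell$ (i.e. $\ell\ell^*\equiv1 \bmod m$). Furthermore, the choreography $Q_n(t)$ is $2\pi m$-periodic and is symmetric with respect to rotations by $2\pi/m$ (that is, the orbit $\{Q_n(t):t\in\mathbb{R}\}\subset\mathbb{C}$ is invariant under rotation by $2\pi/m$).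
   Context: The $n$ vortices of equal circulation on the unit sphere, written in stereographic coordinates $q_j\in\mathbb{C}$, satisfy $$4(1+|q_j|^2)^{-2}\,i\dot q_j=\nabla_{q_j}H(q),\qquad H(q)=-\frac12\sum_{i<j}\ln\frac{|q_j-q_i|^2}{(1+|q_j|^2)(1+|q_i|^2)},$$ with $\nabla_{q_j}$ the real gradient on $\mathbb{R}^2\cong\mathbb{C}$. A relative periodic solution is a solution of the form $q_j(t)=e^{i\omega t}x_j(\nu t)$ with $x_j:\mathbb{R}\to\mathbb{C}$ $2\pi$-periodic. It has symmetry group $\tilde{\mathbb{Z}}_n(k)$ when $$x_j(t)=e^{ij\zeta}x_n(t+jk\zeta)\quad\text{for all } j=1,\dots,n \text{ and all } t .$$ A choreography is a periodic solution in which the $n$ equal vortices follow the same path. *)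

theory Defs
  imports "HOL-Analysis.Analysis"
begin

definition vortex_hamiltonian :: "nat \<Rightarrow> (nat \<Rightarrow> complex) \<Rightarrow> real" where
  "vortex_hamiltonian n z =
     - (1 / 2) * (\<Sum>j\<in>{1..n}. \<Sum>i\<in>{1..<j}.
         ln ((cmod (z j - z i))\<^sup>2 / ((1 + (cmod (z j))\<^sup>2) * (1 + (cmod (z i))\<^sup>2))))"

text \<open>Vortices are indexed by \<open>1, \<dots>, n\<close>; values of \<open>q\<close> at other indices are irrelevant.
  The gradient with respect to \<open>q\<^sub>j\<close> is the real one, taken in the real inner product space
  of complex numbers. Since \<open>ln 0 = 0\<close> in HOL, absence of collisions, implicit in the
  equations of motion, has to be required explicitly.\<close>

definition vortex_solution :: "nat \<Rightarrow> (nat \<Rightarrow> real \<Rightarrow> complex) \<Rightarrow> bool" where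
  "vortex_solution n q \<longleftrightarrow>
     (\<forall>t. \<forall>i\<in>{1..n}. \<forall>j\<in>{1..n}. i \<noteq> j \<longrightarrow> q i t \<noteq> q j t) \<and>
     (\<forall>t. \<forall>j\<in>{1..n}. \<exists>v.
        (q j has_vector_derivative v) (at t) \<and>
        (GDERIV (\<lambda>w. vortex_hamiltonian n ((\<lambda>i. q i t)(j := w))) (q j t) :>
           complex_of_real (4 / (1 + (cmod (q j t))\<^sup>2)\<^sup>2) * \<i> * v))"

definition relative_periodic_solution ::
  "nat \<Rightarrow> real \<Rightarrow> real \<Rightarrow> (nat \<Rightarrow> real \<Rightarrow> complex) \<Rightarrow> (nat \<Rightarrow> real \<Rightarrow> complex) \<Rightarrow> bool" where
  "relative_periodic_solution n \<omega> \<nu> x q \<longleftrightarrow>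
     vortex_solution n q \<and>
     (\<forall>j\<in>{1..n}. \<forall>t. x j (t + 2 * pi) = x j t) \<and>
     (\<forall>j\<in>{1..n}. \<forall>t. q j t = cis (\<omega> * t) * x j (\<nu> * t))"

definition has_symmetry_Z :: "nat \<Rightarrow> nat \<Rightarrow> (nat \<Rightarrow> real \<Rightarrow> complex) \<Rightarrow> bool" where
  "has_symmetry_Z n k x \<longleftrightarrow>
     (let \<zeta> = 2 * pi / real n in
      \<forall>j\<in>{1..n}. \<forall>t. x j t = cis (real j * \<zeta>) * x n (t + real j * real k * \<zeta>))"

definition choreography :: "nat \<Rightarrow> (nat \<Rightarrow> real \<Rightarrow> complex) \<Rightarrow> bool" where
  "choreography n q \<longleftrightarrow>
     vortex_solution n q \<and>
     (\<exists>T>0. \<forall>j\<in>{1..n}. \<forall>t. q j (t + T) = q j t) \<and>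
     (\<forall>i\<in>{1..n}. \<forall>j\<in>{1..n}. range (q i) = range (q j))"

end

theory Submission
  imports Defs
begin

text \<open>
  Since \<open>\<omega> / \<nu> = l / m\<close>, each \<open>Q\<^sub>j(t) = e\<^bsup>itl/m\<^esup> x\<^sub>j(t)\<close> is a \<open>2\<pi>\<close>-periodic curve seen from a
  frame that turns by the angle \<open>2\<pi>l/m\<close> per period. Hence a time shift by \<open>2\<pi>a\<close> acts on \<open>Q\<^sub>j\<close> as
  the rotation by \<open>2\<pi>la/m\<close> (\<open>rotating_frame_shift\<close>). For \<open>a = m\<close> this rotation is trivial, which
  gives the period \<open>2\<pi>m\<close>; for \<open>a = l\<^sup>*\<close> it is the rotation by \<open>2\<pi>/m\<close>, because \<open>l l\<^sup>* \<equiv> 1\<close>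
  modulo \<open>m\<close>, so the path of \<open>Q\<^sub>n\<close> is invariant under that rotation.

  The vortices share one path because \<open>k\<close> may be replaced by \<open>\<kappa> = k - (kl - m)l\<^sup>*\<close>. As \<open>n\<close> divides
  \<open>kl - m\<close>, the numbers \<open>jk\<zeta>\<close> and \<open>j\<kappa>\<zeta>\<close> differ by a multiple of \<open>2\<pi>\<close> and are the same shift of
  \<open>x\<^sub>n\<close>. In the rotating frame, however, they contribute different phases, and \<open>\<kappa>\<close> is chosen so
  that its phase cancels the spatial rotation \<open>e\<^bsup>ij\<zeta>\<^esup>\<close> of the symmetry: the identity
  \<open>\<kappa>l - m = (kl - m)(1 - l l\<^sup>*)\<close> shows that \<open>nm\<close> divides \<open>\<kappa>l - m\<close>, hence
  \<open>j\<kappa>\<zeta>l/m \<equiv> j\<zeta>\<close> modulo \<open>2\<pi>\<close> (\<open>symmetry_rotating_frame\<close>).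
\<close>

lemma periodic_add_int_multiple:
  fixes y :: "real \<Rightarrow> 'a" and a :: int
  assumes per: "\<And>t. y (t + p) = y t"
  shows "y (t + p * of_int a) = y t"
proof (induction a rule: int_induct[where k = 0])
  case base
  then show ?case by simp
next
  case (step1 i)
  then show ?case using per[of "t + p * of_int i"] by (simp add: algebra_simps)
next
  case (step2 i)
  then show ?case using per[of "t + p * of_int (i - 1)"] by (simp add: algebra_simps)
qed

lemma cis_eq_if_diff_multiple_2pi:
  assumes "a - b = 2 * pi * of_int c"
  shows "cis a = cis b"
proof -
  have "cis a = cis b * cis (a - b)"
    by (simp add: cis_mult)
  then show ?thesis
    using assms by simp
qed

lemma rotating_frame_shift:
  fixes y Y :: "real \<Rightarrow> complex" and a :: int
  assumes per: "\<And>t. y (t + 2 * pi) = y t"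
    and Y: "\<And>t. Y t = cis (t * \<alpha>) * y t"
  shows "Y (t + 2 * pi * of_int a) = cis (2 * pi * (\<alpha> * of_int a)) * Y t"
  using periodic_add_int_multiple[where y = y and p = "2 * pi" and a = a and t = t, OF per]
  by (simp add: Y cis_mult algebra_simps)

text \<open>
  The hypothesis on \<open>\<kappa>l - m\<close> makes the phase gained in the rotating frame during the time
  \<open>j\<kappa>\<zeta>\<close> equal to \<open>j\<zeta>\<close>; the one on \<open>k - \<kappa>\<close> makes \<open>x\<^sub>n\<close> unable to tell \<open>\<kappa>\<close> from \<open>k\<close>.
\<close>
lemma symmetry_rotating_frame:
  fixes x :: "nat \<Rightarrow> real \<Rightarrow> complex" and \<kappa> l m :: int
  assumes per: "\<And>t. x n (t + 2 * pi) = x n t"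
    and sym: "has_symmetry_Z n k x"
    and n: "n > 0" and m: "m \<noteq> 0"
    and shift: "int n dvd int k - \<kappa>"
    and phase: "int n * m dvd \<kappa> * l - m"
    and j: "j \<in> {1..n}"
    and \<zeta>: "\<zeta> = 2 * pi / real n"
    and \<alpha>: "\<alpha> = of_int l / of_int m"
  shows "cis (t * \<alpha>) * x j t
    = cis ((t + real j * of_int \<kappa> * \<zeta>) * \<alpha>) * x n (t + real j * of_int \<kappa> * \<zeta>)"
proof -
  obtain c where "int k - \<kappa> = int n * c"
    using shift by blast
  then have c: "real k = of_int \<kappa> + real n * of_int c"
    by (metis add_diff_cancel_left' add.commute diff_add_cancel of_int_add of_int_mult of_int_of_nat_eq)
  obtain d where "\<kappa> * l - m = int n * m * d"
    using phase by blast
  then have "\<kappa> * l = m + int n * m * d"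
    by simp
  then have d: "of_int \<kappa> * of_int l = (of_int m + real n * of_int m * of_int d :: real)"
    by (metis of_int_add of_int_mult of_int_of_nat_eq)
  have "t + real j * real k * \<zeta>
      = t + real j * of_int \<kappa> * \<zeta> + 2 * pi * of_int (int j * c)"
    using n by (simp add: c \<zeta> field_simps)
  then have same_shift: "x n (t + real j * real k * \<zeta>) = x n (t + real j * of_int \<kappa> * \<zeta>)"
    using periodic_add_int_multiple[where y = "x n", OF per] by metis
  have "of_int \<kappa> * \<alpha> = 1 + real n * of_int d"
    using d m by (simp add: \<alpha> field_simps)
  then have "real j * \<zeta> * (of_int \<kappa> * \<alpha>) - real j * \<zeta> = 2 * pi * of_int (int j * d)"
    using n by (simp add: \<zeta> field_simps)
  then have "cis (real j * \<zeta> * (of_int \<kappa> * \<alpha>)) = cis (real j * \<zeta>)"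
    by (rule cis_eq_if_diff_multiple_2pi)
  moreover have "x j t = cis (real j * \<zeta>) * x n (t + real j * real k * \<zeta>)"
    using sym j unfolding has_symmetry_Z_def Let_def \<zeta> by blast
  moreover have "cis ((t + real j * of_int \<kappa> * \<zeta>) * \<alpha>)
      = cis (t * \<alpha>) * cis (real j * \<zeta> * (of_int \<kappa> * \<alpha>))"
    by (simp only: cis_mult) (simp only: algebra_simps)
  ultimately show ?thesis
    by (simp add: same_shift)
qed

lemma range_time_shift:
  fixes f g :: "real \<Rightarrow> 'a"
  assumes "\<And>t. f t = g (t + s)"
  shows "range f = range g"
proof -
  have "f = g \<circ> (\<lambda>t. t + s)"
    using assms by (simp add: fun_eq_iff)
  then have "range f = g ` range (\<lambda>t. t + s)"
    by (simp only: image_comp)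
  moreover have "range (\<lambda>t. t + s) = UNIV"
    by (metis surj_plus surj_def add.commute)
  ultimately show ?thesis
    by simp
qed

lemma range_time_scale:
  fixes f g :: "real \<Rightarrow> 'a"
  assumes "\<And>t. g t = f (t / c)" and "c \<noteq> 0"
  shows "range g = range f"
proof -
  have "g (c * t) = f t" for t
    using assms by simp
  then show ?thesis
    using assms(1) by (metis (mono_tags, lifting) rangeE rangeI subsetI subset_antisym)
qed

theorem theorem10:
  fixes n k :: nat
    and l m lstar ktilde :: int
    and r \<zeta> \<omega> \<nu> :: real
    and x q Q :: "nat \<Rightarrow> real \<Rightarrow> complex"
  assumes "n \<ge> 2" and "r > 0"
    and "\<zeta> = 2 * pi / real n"
    and "\<omega> = (real n - 1) * ((1 - r ^ 4) / (8 * r\<^sup>2))"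
    and "k \<in> {1..n}"
    and "relative_periodic_solution n \<omega> \<nu> x q"
    and "has_symmetry_Z n k x"
    and "l \<noteq> 0" and "m \<noteq> 0" and "coprime l m"
    and "int n dvd int k * l - m"
    and "\<nu> = \<omega> * (real_of_int m / real_of_int l)" and "\<nu> > 0"
    and "\<And>j t. j \<in> {1..n} \<Longrightarrow> Q j t = q j (t / \<nu>)"
    and "(l * lstar) mod m = 1 mod m"
    and "ktilde = int k - (int k * l - m) * lstar"
  shows "(\<forall>j\<in>{1..n}. \<forall>t. Q j t = cis (t * \<omega> / \<nu>) * x j t) \<and>
     (\<forall>j\<in>{1..n}. \<forall>t. Q j t = Q n (t + real j * real_of_int ktilde * \<zeta>)) \<and>
     (choreography n q) \<and>
     (\<forall>t. Q n (t + 2 * pi * real_of_int m) = Q n t) \<and>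
     ((\<lambda>z. cis (2 * pi / real_of_int m) * z) ` range (Q n) = range (Q n))"
proof -
  let ?\<alpha> = "real_of_int l / real_of_int m"
  have per: "x j (t + 2 * pi) = x j t" if "j \<in> {1..n}" for j t
    using assms(6) that by (simp add: relative_periodic_solution_def)
  have ratio: "\<omega> / \<nu> = ?\<alpha>"
    using assms(8,9,12,13) by (auto simp: field_simps)
  have Q_rot: "Q j t = cis (t * \<omega> / \<nu>) * x j t" if "j \<in> {1..n}" for j t
    using assms(6,13,14) that by (simp add: relative_periodic_solution_def mult.commute)
  have Q: "Q j t = cis (t * ?\<alpha>) * x j t" if "j \<in> {1..n}" for j t
    using Q_rot[OF that] ratio by (metis times_divide_eq_right)
  have Q_turn: "Q j (t + 2 * pi * of_int a) = cis (2 * pi * (?\<alpha> * of_int a)) * Q j t"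
    if "j \<in> {1..n}" for j t a
    using per[OF that] Q[OF that] by (rule rotating_frame_shift)
  have n: "n \<in> {1..n}"
    using assms(1) by simp
  have inv: "m dvd 1 - l * lstar"
    using assms(15) by (metis mod_eq_dvd_iff)

  have "int n dvd int k - ktilde"
    using assms(11,16) by simp
  moreover have "ktilde * l - m = (int k * l - m) * (1 - l * lstar)"
    unfolding assms(16) by (simp add: algebra_simps)
  then have "int n * m dvd ktilde * l - m"
    using assms(11) inv by (simp add: mult_dvd_mono)
  ultimately have Q_n: "Q j t = Q n (t + real j * of_int ktilde * \<zeta>)" if "j \<in> {1..n}" for j t
    using symmetry_rotating_frame[where x = x, OF per[OF n] assms(7) _ assms(9) _ _ that assms(3) refl]
      assms(1) by (simp add: Q[OF that] Q[OF n])

  have Q_period: "Q j (t + 2 * pi * of_int (m * a)) = Q j t" if "j \<in> {1..n}" for j t a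
  proof -
    have "cis (2 * pi * (?\<alpha> * of_int (m * a))) = cis (2 * pi * of_int (l * a))"
      using assms(9) by simp
    then show ?thesis
      using Q_turn[OF that, of t "m * a"] by simp
  qed

  have "cis (2 * pi / of_int m) * Q n t = Q n (t + 2 * pi * of_int lstar)" for t
  proof -
    obtain b where "1 - l * lstar = m * b"
      using inv by blast
    then have "of_int l * of_int lstar = (1 - of_int m * of_int b :: real)"
      by (metis add_diff_cancel_left' diff_add_cancel of_int_1 of_int_diff of_int_mult)
    then have "of_int b = 1 / of_int m - ?\<alpha> * of_int lstar"
      using assms(9) by (simp add: field_simps)
    then have "2 * pi / of_int m - 2 * pi * (?\<alpha> * of_int lstar) = 2 * pi * of_int b"
      by (simp add: right_diff_distrib)
    then show ?thesis
      unfolding Q_turn[OF n] by (metis cis_eq_if_diff_multiple_2pi)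
  qed
  then have "range (\<lambda>t. cis (2 * pi / of_int m) * Q n t) = range (Q n)"
    by (rule range_time_shift)
  then have rotation: "(\<lambda>z. cis (2 * pi / of_int m) * z) ` range (Q n) = range (Q n)"
    by (simp add: image_image)

  have range_q: "range (q j) = range (Q n)" if "j \<in> {1..n}" for j
  proof -
    have "range (Q j) = range (q j)"
      using range_time_scale[of "Q j" "q j" \<nu>] assms(13,14) that by simp
    moreover have "range (Q j) = range (Q n)"
      using Q_n[OF that] by (rule range_time_shift)
    ultimately show ?thesis
      by simp
  qed
  have q: "q j t = Q j (\<nu> * t)" if "j \<in> {1..n}" for j t
    using assms(13,14) that by simp
  \<comment> \<open>The modulus \<open>m\<close> may be negative, but a period has to be positive.\<close>
  have q_period: "q j (t + 2 * pi * \<bar>of_int m\<bar> / \<nu>) = q j t" if "j \<in> {1..n}" for j t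
  proof -
    have "\<nu> * (t + 2 * pi * \<bar>of_int m\<bar> / \<nu>) = \<nu> * t + 2 * pi * of_int (m * sgn m)"
      using assms(13) by (simp add: field_simps sgn_if abs_if)
    then show ?thesis
      unfolding q[OF that] by (metis Q_period[OF that])
  qed
  have "2 * pi * \<bar>of_int m\<bar> / \<nu> > 0"
    using assms(9,13) by simp
  then have "\<exists>T>0. \<forall>j\<in>{1..n}. \<forall>t. q j (t + T) = q j t"
    using q_period by blast
  moreover have "vortex_solution n q"
    using assms(6) by (simp add: relative_periodic_solution_def)
  ultimately have "choreography n q"
    using range_q by (simp add: choreography_def)
  moreover have "Q n (t + 2 * pi * of_int m) = Q n t" for t
    using Q_period[OF n, of t 1] by simp
  ultimately show ?thesis
    using Q_rot Q_n rotation by blast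
qed

end
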